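(* The mean of the external profile $B_{n,k}$ of a random symmetric digital search tree of size $n$ satisfies \[ \mathbb{E}(B_{n,k}) = 2^k F(2^{-k}n) + \mathcal{O}(1), \] uniformly for $0\le k\le n$, where $F(x)$ is a positive function on $\mathbb{R}^+=(0,\infty)$ defined by \[ F(x)=\sum_{j\ge 0}\frac{(-1)^j 2^{-\binom{j}{2}}}{Q_jQ_\infty}\,e^{-2^jx}. \]
   Context: Notation: $Q_n=\prod_{1\le \ell\le n}(1-2^{-\ell})$ (so $Q_0=1$) and $Q_\infty=\prod_{\ell\ge1}(1-2^{-\ell})$. Random symmetric digital search tree (DST) of size $n$: one is given a sequence of $n$ records, each an infinite string of bits, all bits of all records being independent and uniform on $\{0,1\}$. If $n=0$ the tree is a single external node. If $n\ge1$, the first record is stored in the root (an internal node, at level $0$); the remaining $n-1$ records are distributed, retaining their relative order, to the left or right subtree according as their first bit is $0$ or $1$; the subtrees are built recursively by the same rule, using the $j$th bit for the next $j$th branching. Thus the tree is a binary tree with $n$ internal nodes (holding the records) and $n+1$ external nodes (empty places). External profile: $B_{n,k}$ is the number of external nodes at level (distance from the root) $k$. Equivalently, $B_{0,0}=1$, $B_{0,k}=0$ for $k\ge1$, $B_{n,0}=0$ for $n\ge1$, and for $n,k\ge1$, $B_{n,k}\stackrel{d}{=}B_{J_n,k-1}+B^*_{n-1-J_n,k-1}$, where $J_n$ is Binomial$(n-1,\frac12)$, and $B^*$ is an independent copy of $B$ (both independent of $J_n$). *)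

theory Defs
  imports
    "HOL-Probability.Probability"
    "HOL-Library.Tree"
begin

(* Internal nodes of the binary tree are the constructor Node, which stores a record; external
   nodes are the constructor Leaf. The argument d is the level of the root of the subtree that is
   being built, so that bit number d (counted from 0) of a record decides the next branching:
   left on 0 (False), right on 1 (True). The tree of interest is dst 0. *)

function dst :: "nat \<Rightarrow> bool stream list \<Rightarrow> bool stream tree" where
  "dst d [] = Leaf"
| "dst d (r # rs) =
     Node (dst (Suc d) (filter (\<lambda>s. \<not> s !! d) rs)) r (dst (Suc d) (filter (\<lambda>s. s !! d) rs))"
  by pat_completeness auto
termination
  by (relation "Wellfounded.measure (\<lambda>(d, rs). length rs)") (auto simp: less_Suc_eq_le)

fun ext_profile :: "'a tree \<Rightarrow> nat \<Rightarrow> nat" where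
  "ext_profile Leaf 0 = 1"
| "ext_profile Leaf (Suc k) = 0"
| "ext_profile (Node l a r) 0 = 0"
| "ext_profile (Node l a r) (Suc k) = ext_profile l k + ext_profile r k"

(* An infinite sequence of independent records, each an infinite sequence of independent fair
   bits. The tree of size n is built from the first n records, so all sizes share one
   probability space. *)

definition fair_bit :: "bool measure" where
  "fair_bit = measure_pmf (bernoulli_pmf (1 / 2))"

definition records :: "bool stream stream measure" where
  "records = stream_space (stream_space fair_bit)"

definition B :: "nat \<Rightarrow> nat \<Rightarrow> bool stream stream \<Rightarrow> nat" where
  "B n k \<omega> = ext_profile (dst 0 (stake n \<omega>)) k"

definition mean_B :: "nat \<Rightarrow> nat \<Rightarrow> real" where
  "mean_B n k = prob_space.expectation records (\<lambda>\<omega>. real (B n k \<omega>))"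

definition Q :: "nat \<Rightarrow> real" where
  "Q n = (\<Prod>l = 1..n. 1 - (1 / 2) ^ l)"

definition Q_inf :: real where
  "Q_inf = (\<Prod>l. 1 - (1 / 2) ^ Suc l)"

definition F_term :: "real \<Rightarrow> nat \<Rightarrow> real" where
  "F_term x j = (- 1) ^ j * (1 / 2) ^ (j choose 2) / (Q j * Q_inf) * exp (- (2 ^ j * x))"

definition F :: "real \<Rightarrow> real" where
  "F x = (\<Sum>j. F_term x j)"


lemma prob_space_fair_bit: "prob_space fair_bit"
  unfolding fair_bit_def by (rule prob_space_measure_pmf)

lemma prob_space_records: "prob_space records"
  unfolding records_def
  by (intro prob_space.prob_space_stream_space prob_space_fair_bit)

lemma ext_profile_le_size: "ext_profile t k \<le> Suc (size t)"
proof (induction t k rule: ext_profile.induct)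
  case (4 l a r k)
  then show ?case by simp
qed auto

lemma size_dst: "size (dst d rs) = length rs"
proof (induction d rs rule: dst.induct)
  case (2 d r rs)
  then show ?case
    using sum_length_filter_compl[of "\<lambda>s. s !! d" rs] by simp
qed simp

lemma B_le: "B n k \<omega> \<le> Suc n"
  using ext_profile_le_size[of "dst 0 (stake n \<omega>)" k] by (simp add: B_def size_dst)

lemma ext_profile_dst_cong:
  assumes "list_all2 (\<lambda>r s. \<forall>i<d + k. r !! i = s !! i) rs ss"
  shows "ext_profile (dst d rs) k = ext_profile (dst d ss) k"
  using assms
proof (induction k arbitrary: d rs ss)
  case 0
  then show ?case by (cases rs; cases ss) auto
next
  case (Suc k)
  show ?case
  proof (cases rs)
    case Nil
    then show ?thesis using Suc.prems by simp
  next
    case (Cons r rs')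
    then obtain s ss' where ss: "ss = s # ss'"
      and *: "list_all2 (\<lambda>r s. \<forall>i<d + Suc k. r !! i = s !! i) rs' ss'"
      using Suc.prems by (auto simp: list_all2_Cons1)
    have "list_all2 (\<lambda>r s. \<forall>i<Suc d + k. r !! i = s !! i)
            (filter (\<lambda>s. s !! d = b) rs') (filter (\<lambda>s. s !! d = b) ss')" for b
      using * by (induction rule: list_all2_induct) auto
    from Suc.IH[OF this[of True]] Suc.IH[OF this[of False]] show ?thesis
      by (simp add: Cons ss)
  qed
qed

lemma measurable_B: "B n k \<in> records \<rightarrow>\<^sub>M count_space UNIV"
proof -
  define pre :: "bool stream stream \<Rightarrow> bool list list"
    where "pre \<omega> = stake n (smap (stake k) \<omega>)" for \<omega>
  define g where "g xss = ext_profile (dst 0 (map (\<lambda>xs. xs @- sconst False) xss)) k" for xss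
  have "B n k \<omega> = g (pre \<omega>)" for \<omega>
    unfolding B_def g_def pre_def stake_smap map_map
    by (rule ext_profile_dst_cong)
       (simp add: list_all2_conv_all_nth shift_snth_less)
  then have eq: "B n k = g \<circ> pre"
    by auto
  have m1: "stake k \<in> stream_space fair_bit \<rightarrow>\<^sub>M count_space (UNIV :: bool list set)"
  proof -
    have "stream_space fair_bit \<rightarrow>\<^sub>M count_space (UNIV :: bool list set) =
          stream_space (count_space UNIV) \<rightarrow>\<^sub>M count_space UNIV"
      by (intro measurable_cong_sets sets_stream_space_cong) (simp_all add: fair_bit_def)
    then show ?thesis using measurable_stake[where 'a = bool] by simp
  qed
  have "smap (stake k) \<in> records \<rightarrow>\<^sub>M stream_space (count_space (UNIV :: bool list set))"
    unfolding records_def using m1 by (rule measurable_smap)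
  then have "pre \<in> records \<rightarrow>\<^sub>M count_space UNIV"
    unfolding pre_def by (rule measurable_compose[OF _ measurable_stake])
  then show ?thesis
    unfolding eq by (rule measurable_comp) simp
qed

lemma integrable_B: "integrable records (\<lambda>\<omega>. real (B n k \<omega>))"
proof -
  interpret prob_space records by (rule prob_space_records)
  have "(\<lambda>\<omega>. real (B n k \<omega>)) \<in> borel_measurable records"
    using measurable_compose[OF measurable_B, of real borel] by simp
  then show ?thesis
    by (rule integrable_const_bound[where B = "real (Suc n)", rotated])
       (use B_le in \<open>auto simp del: of_nat_Suc\<close>)
qed

lemma Q_pos: "Q n > 0"
  unfolding Q_def by (intro prod_pos) (auto simp: power_less_one_iff)

lemma convergent_prod_Q: "convergent_prod (\<lambda>l. 1 - (1 / 2 :: real) ^ Suc l)"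
proof -
  have "summable (\<lambda>l. norm ((1 - (1 / 2 :: real) ^ Suc l) - 1))"
    by (simp add: power_abs summable_mult summable_geometric)
  then show ?thesis
    by (intro abs_convergent_prod_imp_convergent_prod summable_imp_abs_convergent_prod)
qed

lemma Q_tendsto_Q_inf: "Q \<longlonglongrightarrow> Q_inf"
proof -
  have "(\<lambda>n. \<Prod>l\<le>n. 1 - (1 / 2 :: real) ^ Suc l) \<longlonglongrightarrow> Q_inf"
    unfolding Q_inf_def by (rule convergent_prod_LIMSEQ[OF convergent_prod_Q])
  moreover have "(\<Prod>l\<le>n. 1 - (1 / 2 :: real) ^ Suc l) = Q (Suc n)" for n
    unfolding Q_def by (rule prod.reindex_bij_witness[of _ "\<lambda>l. l - 1" Suc]) auto
  ultimately show ?thesis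
    by (simp add: filterlim_sequentially_Suc)
qed

lemma Q_inf_nonzero: "Q_inf \<noteq> 0"
proof -
  have "1 - (1 / 2 :: real) ^ Suc l \<noteq> 0" for l
    using power_Suc_less_one[of "1 / 2 :: real" l] by linarith
  then show ?thesis
    unfolding Q_inf_def by (rule prodinf_nonzero[OF convergent_prod_Q])
qed

lemma summable_F_term:
  assumes "x \<ge> 0"
  shows "summable (F_term x)"
proof (rule summable_ratio_test[where c = "1 / 2" and N = 2])
  fix j :: nat
  assume j: "2 \<le> j"
  have h: "(1 / 2 :: real) ^ j \<le> (1 / 2) ^ 2"
    using j by (intro power_decreasing) auto
  have Q: "Q (Suc j) = Q j * (1 - (1 / 2) ^ Suc j)"
    by (simp add: Q_def)
  have ch: "Suc j choose 2 = j + (j choose 2)"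
    by (simp add: numeral_2_eq_2)
  define e where "e i = exp (- (2 ^ i * x))" for i :: nat
  define A where "A = (1 / 2 :: real) ^ (j choose 2) / (Q j * \<bar>Q_inf\<bar>)"
  have A: "A \<ge> 0" using Q_pos[of j] by (simp add: A_def)
  have e: "0 \<le> e (Suc j)" "e (Suc j) \<le> e j"
    using assms by (auto simp: e_def intro!: mult_right_mono)
  have r: "(1 / 2 :: real) ^ j / (1 - (1 / 2) ^ Suc j) \<le> 1 / 2"
    and p: "0 < 1 - (1 / 2 :: real) ^ Suc j"
    using h by (auto simp: divide_simps power2_eq_square)
  have "norm (F_term x (Suc j)) = A * ((1 / 2) ^ j / (1 - (1 / 2) ^ Suc j)) * e (Suc j)"
    using Q_pos[of j] p
    by (simp add: F_term_def A_def e_def Q ch abs_mult power_abs power_add mult_ac del: power_Suc)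
  also have "\<dots> \<le> A * (1 / 2) * e j"
    using A e r p by (intro mult_mono) auto
  also have "\<dots> = 1 / 2 * norm (F_term x j)"
    using Q_pos[of j] by (simp add: F_term_def A_def e_def abs_mult power_abs)
  finally show "norm (F_term x (Suc j)) \<le> 1 / 2 * norm (F_term x j)" .
qed simp

end

theory Submission
  imports Defs "HOL-Real_Asymp.Real_Asymp"
begin

text \<open>
  The mean profile is governed by one path at a time. Each of the \<open>2\<^sup>k\<close> words of length \<open>k\<close> is a
  possible node at level \<open>k\<close>. On the path to it there is one external node at any time, whose depth
  starts in \<open>0\<close> and moves from \<open>m\<close> to \<open>m + 1\<close> with probability \<open>2\<^sup>-\<^sup>m\<close> when a record arrives. Hence
  the mean profile is \<open>2\<^sup>k p\<^sub>n(k)\<close>, where \<open>p\<^sub>n(k)\<close> is the probability that this Markov chain is in \<open>k\<close>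
  after \<open>n\<close> steps (\<open>mean_B_eq_depth_prob\<close>).

  The chain only moves up, so its law is explicit (\<open>depth_prob_closed_form\<close>):
  \<open>p\<^sub>n(k) = \<Sum>\<^sub>j\<^sub>\<le>\<^sub>k (-1)\<^sup>j 2^(- (j choose 2)) / (Q\<^sub>j Q\<^sub>k\<^sub>-\<^sub>j) (1 - 2\<^sup>j\<^sup>-\<^sup>k)\<^sup>n\<close>.
  Termwise this is the series for \<open>F (n / 2\<^sup>k)\<close>, with \<open>Q\<^sub>k\<^sub>-\<^sub>j\<close> in place of its limit and a power of
  \<open>1 - y\<close> in place of \<open>exp (- n y)\<close>, where \<open>y = 2\<^sup>j\<^sup>-\<^sup>k\<close>. Both replacements cost \<open>O(y)\<close> uniformly in \<open>n\<close>,
  and the weights \<open>2^(- (j choose 2))\<close> make \<open>2\<^sup>j\<close> summable. So \<open>p\<^sub>n(k)\<close> and \<open>F (n / 2\<^sup>k)\<close> differ by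
  \<open>O(2\<^sup>-\<^sup>k)\<close> (\<open>depth_prob_approx_F\<close>), and multiplication by \<open>2\<^sup>k\<close> gives the expansion of the mean.

  Positivity of \<open>F\<close> is a consequence of the same estimate. As a limit of probabilities, \<open>F\<close> is
  nonnegative (\<open>F_nonneg\<close>). It satisfies \<open>F' x = 2 F (2 x) - F x\<close>, so \<open>exp x * F x\<close> has the derivative
  \<open>2 exp x * F (2 x) \<ge> 0\<close>. A zero of \<open>F\<close> would spread to the left by monotonicity
  and then to the right by the dilation in this equation, against \<open>exp x * F x \<longlonglongrightarrow> 1 / Q_inf\<close> at infinity (\<open>F_pos\<close>).
\<close>

section \<open>The depth of the external node on a path\<close>

text \<open>
  Follow one path out of a node at level \<open>d\<close>: along it there is always exactly one external node,
  and a new record moves it one level down precisely if the record agrees with the path that far.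
  The argument \<open>m\<close> is the current depth of that external node below level \<open>d\<close>. The path is given
  only up to the length of \<open>w\<close>, so a depth beyond \<open>length w\<close> never changes any more; this is
  harmless when the question is whether the final depth equals \<open>length w\<close>.
\<close>
primrec path_depth :: "nat \<Rightarrow> bool list \<Rightarrow> nat \<Rightarrow> bool stream list \<Rightarrow> nat" where
  "path_depth d w m [] = m"
| "path_depth d w m (r # rs) =
     path_depth d w (if stake m (sdrop d r) = take m w then Suc m else m) rs"

lemma path_depth_ge: "m \<le> path_depth d w m rs"
  by (induction rs arbitrary: m) (auto intro: Suc_leD)

text \<open>
  Below the root, only the records that take the first step of the path matter, and they see the
  path that remains.
\<close>
lemma path_depth_Cons:
  "path_depth d (b # w) (Suc m) rs = Suc (path_depth (Suc d) w m (filter (\<lambda>r. r !! d = b) rs))"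
  by (induction rs arbitrary: m) auto

lemma sum_words_Suc:
  fixes g :: "bool list \<Rightarrow> 'a :: comm_monoid_add"
  shows "(\<Sum>w | length w = Suc k. g w) =
    (\<Sum>w | length w = k. g (False # w)) + (\<Sum>w | length w = k. g (True # w))"
proof -
  have fin: "finite {w :: bool list. length w = k}"
    using finite_lists_length_eq[of "UNIV :: bool set" k] by simp
  have "{w :: bool list. length w = Suc k} =
      (#) False ` {w. length w = k} \<union> (#) True ` {w. length w = k}"
    by (auto simp: length_Suc_conv image_iff)
  also have "sum g \<dots> = sum g ((#) False ` {w. length w = k}) + sum g ((#) True ` {w. length w = k})"
    by (rule sum.union_disjoint) (use fin in auto)
  finally show ?thesis
    by (simp add: sum.reindex)
qed

text \<open>
  A node at level \<open>k\<close> is a word of length \<open>k\<close>, and it is external exactly if the unique external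
  node on the path to it lies at depth \<open>k\<close>. This replaces the branching recursion for the tree by
  one process per path.
\<close>
lemma ext_profile_dst_eq_sum:
  "ext_profile (dst d rs) k = (\<Sum>w | length w = k. of_bool (path_depth d w 0 rs = k))"
proof (induction k arbitrary: d rs)
  case 0
  show ?case
  proof (cases rs)
    case (Cons r rs')
    then show ?thesis
      using path_depth_ge[of 1 d "[]" rs'] by auto
  qed simp
next
  case (Suc k)
  show ?case
  proof (cases rs)
    case (Cons r rs')
    have "path_depth d (b # w) 0 rs = Suc (path_depth (Suc d) w 0 (filter (\<lambda>s. s !! d = b) rs'))" for b w
      by (simp add: Cons path_depth_Cons del: One_nat_def)
    then show ?thesis
      by (simp add: Cons sum_words_Suc Suc.IH)
  qed simp
qed

section \<open>The law of the depth and the mean profile\<close>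

text \<open>
  Under the model, the depth on a fixed path is a Markov chain which moves from \<open>m\<close> to \<open>m + 1\<close> with
  probability \<open>2\<^sup>-\<^sup>m\<close> and otherwise stays (the chain of Morris's approximate counting).
  \<open>depth_prob k m n\<close> is its probability of being in \<open>k\<close> after \<open>n\<close> steps from \<open>m\<close>. The recursion
  conditions on the first step because a stream of records gives access to its first element.
\<close>
primrec depth_prob :: "nat \<Rightarrow> nat \<Rightarrow> nat \<Rightarrow> real" where
  "depth_prob k m 0 = of_bool (m = k)"
| "depth_prob k m (Suc n) =
     (1 / 2) ^ m * depth_prob k (Suc m) n + (1 - (1 / 2) ^ m) * depth_prob k m n"

lemma depth_prob_nonneg: "depth_prob k m n \<ge> 0"
  by (induction n arbitrary: m) (auto simp: power_le_one)

lemma depth_prob_eq_0: "k < m \<Longrightarrow> depth_prob k m n = 0"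
  by (induction n arbitrary: m) auto

lemma measurable_stake_bits [measurable]:
  "stake m \<in> stream_space fair_bit \<rightarrow>\<^sub>M count_space (UNIV :: bool list set)"
proof -
  have "stream_space fair_bit \<rightarrow>\<^sub>M count_space (UNIV :: bool list set) =
        stream_space (count_space UNIV) \<rightarrow>\<^sub>M count_space UNIV"
    by (intro measurable_cong_sets sets_stream_space_cong) (simp_all add: fair_bit_def)
  then show ?thesis
    using measurable_stake[where 'a = bool] by simp
qed

lemma sets_records [measurable_cong]:
  "sets records = sets (stream_space (stream_space fair_bit))"
  by (simp add: records_def)

lemma measurable_path_depth [measurable]:
  "(\<lambda>\<omega>. path_depth 0 w m (stake n \<omega>)) \<in> records \<rightarrow>\<^sub>M count_space UNIV"
proof (induction n arbitrary: m)
  case (Suc n)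
  note Suc.IH [measurable]
  have [measurable]: "stl \<in> records \<rightarrow>\<^sub>M records" "shd \<in> records \<rightarrow>\<^sub>M stream_space fair_bit"
    by (simp_all add: records_def)
  have "(\<lambda>\<omega>. if stake m (shd \<omega>) = take m w then path_depth 0 w (Suc m) (stake n (stl \<omega>))
          else path_depth 0 w m (stake n (stl \<omega>))) \<in> records \<rightarrow>\<^sub>M count_space UNIV"
    by measurable
  then show ?case
    by (simp add: if_distrib[of "\<lambda>m. path_depth 0 w m rs" for rs])
qed simp

lemma emeasure_stake_eq:
  "emeasure (stream_space fair_bit) {r \<in> space (stream_space fair_bit). stake (length v) r = v} =
    ennreal ((1 / 2) ^ length v)"
proof (induction v)
  case Nil
  interpret prob_space "stream_space fair_bit"
    by (intro prob_space.prob_space_stream_space prob_space_fair_bit)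
  show ?case
    using emeasure_space_1 by simp
next
  case (Cons b v)
  interpret prob_space fair_bit by (rule prob_space_fair_bit)
  have "emeasure (stream_space fair_bit)
      {r \<in> space (stream_space fair_bit). stake (length (b # v)) r = b # v} =
    (\<integral>\<^sup>+t. emeasure (stream_space fair_bit) {r \<in> space (stream_space fair_bit).
        t ## r \<in> {r \<in> space (stream_space fair_bit). stake (length (b # v)) r = b # v}} \<partial>fair_bit)"
    by (rule emeasure_stream_space) measurable
  also have "\<dots> = (\<integral>\<^sup>+t. ennreal ((1 / 2) ^ length v) * indicator {b} t \<partial>fair_bit)"
    by (intro nn_integral_cong)
       (auto simp: space_stream_space fair_bit_def indicator_def Cons.IH[symmetric])
  also have "\<dots> = ennreal ((1 / 2) ^ length v) * emeasure fair_bit {b}"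
    by (subst nn_integral_cmult_indicator) (auto simp: fair_bit_def)
  also have "emeasure fair_bit {b} = ennreal (1 / 2)"
    by (cases b) (simp_all add: fair_bit_def emeasure_pmf_single)
  finally show ?case
    by (simp add: ennreal_mult'[symmetric] mult.commute del: ennreal_half)
qed

text \<open>
  Split off the first record: it agrees with the path for \<open>m\<close> bits with probability \<open>2\<^sup>-\<^sup>m\<close>, and it is
  independent of the stream of the remaining ones.
\<close>
lemma emeasure_path_depth_eq:
  "emeasure records {\<omega> \<in> space records. path_depth 0 w m (stake n \<omega>) = length w} =
    ennreal (depth_prob (length w) m n)"
proof (induction n arbitrary: m)
  case 0
  interpret prob_space records by (rule prob_space_records)
  show ?case
    using emeasure_space_1 by simp
next
  case (Suc n)
  let ?S = "stream_space fair_bit" and ?k = "length w"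
  interpret S: prob_space ?S
    by (intro prob_space.prob_space_stream_space prob_space_fair_bit)
  show ?case
  proof (cases "m \<le> ?k")
    \<comment> \<open>The depth never decreases, so it cannot come back to the level of the node.\<close>
    case False
    then have "path_depth 0 w m rs \<noteq> ?k" for rs
      using path_depth_ge[of m 0 w rs] by linarith
    then show ?thesis
      using False by (simp add: depth_prob_eq_0 del: depth_prob.simps path_depth.simps stake.simps)
  next
    case True
    define A where "A = {r \<in> space ?S. stake m r = take m w}"
    have A [measurable]: "A \<in> sets ?S"
      unfolding A_def by measurable
    have "S.prob A = (1 / 2) ^ m"
      using emeasure_stake_eq[of "take m w"] True
      by (simp add: A_def min_absorb2 S.emeasure_eq_measure)
    moreover have "S.prob (space ?S - A) = 1 - (1 / 2) ^ m"
      by (simp add: S.prob_compl calculation)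
    ultimately have emA: "emeasure ?S A = ennreal ((1 / 2) ^ m)"
        "emeasure ?S (space ?S - A) = ennreal (1 - (1 / 2) ^ m)"
      by (simp_all add: S.emeasure_eq_measure)
    have "emeasure records {\<omega> \<in> space records. path_depth 0 w m (stake (Suc n) \<omega>) = ?k} =
      (\<integral>\<^sup>+r. emeasure records {\<omega> \<in> space records.
         r ## \<omega> \<in> {\<omega> \<in> space records. path_depth 0 w m (stake (Suc n) \<omega>) = ?k}} \<partial>?S)"
      unfolding records_def
      by (rule S.emeasure_stream_space) (unfold records_def[symmetric], measurable)
    also have "\<dots> = (\<integral>\<^sup>+r. ennreal (depth_prob ?k (Suc m) n) * indicator A r +
        ennreal (depth_prob ?k m n) * indicator (space ?S - A) r \<partial>?S)"
    proof (intro nn_integral_cong)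
      fix r assume r: "r \<in> space ?S"
      have "{\<omega> \<in> space records. r ## \<omega> \<in> {\<omega> \<in> space records. path_depth 0 w m (stake (Suc n) \<omega>) = ?k}} =
        {\<omega> \<in> space records. path_depth 0 w (if r \<in> A then Suc m else m) (stake n \<omega>) = ?k}"
        using r by (auto simp: records_def space_stream_space[of ?S] A_def)
      then show "emeasure records {\<omega> \<in> space records.
           r ## \<omega> \<in> {\<omega> \<in> space records. path_depth 0 w m (stake (Suc n) \<omega>) = ?k}} =
        ennreal (depth_prob ?k (Suc m) n) * indicator A r +
        ennreal (depth_prob ?k m n) * indicator (space ?S - A) r"
        using r by (simp add: Suc.IH indicator_def)
    qed
    also have "\<dots> = ennreal (depth_prob ?k (Suc m) n) * ennreal ((1 / 2) ^ m) +
        ennreal (depth_prob ?k m n) * ennreal (1 - (1 / 2) ^ m)"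
      by (simp add: nn_integral_add nn_integral_cmult_indicator emA)
    also have "\<dots> = ennreal (depth_prob ?k m (Suc n))"
      by (simp add: ennreal_mult'[symmetric] ennreal_plus[symmetric] depth_prob_nonneg power_le_one
          mult.commute del: ennreal_plus)
    finally show ?thesis .
  qed
qed

lemma card_words: "card {w :: bool list. length w = k} = 2 ^ k"
  using card_lists_length_eq[of "UNIV :: bool set" k] by simp

text \<open>
  The law of the depth is the same on all \<open>2\<^sup>k\<close> paths, by symmetry of the bits.
\<close>
lemma mean_B_eq_depth_prob: "mean_B n k = 2 ^ k * depth_prob k 0 n"
proof -
  interpret prob_space records by (rule prob_space_records)
  define E where "E w = {\<omega> \<in> space records. path_depth 0 w 0 (stake n \<omega>) = k}" for w
  have E [measurable]: "E w \<in> sets records" for w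
    unfolding E_def by measurable
  have "mean_B n k = expectation (\<lambda>\<omega>. \<Sum>w | length w = k. indicator (E w) \<omega>)"
    unfolding mean_B_def B_def ext_profile_dst_eq_sum
    by (intro Bochner_Integration.integral_cong) (auto simp: E_def indicator_def intro!: sum.cong)
  also have "\<dots> = (\<Sum>w | length w = k. prob (E w))"
    by (subst Bochner_Integration.integral_sum) (auto simp: emeasure_eq_measure)
  also have "\<dots> = (\<Sum>w :: bool list | length w = k. depth_prob k 0 n)"
  proof (rule sum.cong)
    fix w :: "bool list" assume "w \<in> {w. length w = k}"
    then show "prob (E w) = depth_prob k 0 n"
      using emeasure_path_depth_eq[of w 0 n] by (simp add: E_def emeasure_eq_measure depth_prob_nonneg)
  qed simp
  finally show ?thesis
    by (simp add: card_words)
qed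

lemma depth_prob_0_Suc: "depth_prob 0 m (Suc n) = 0"
  by (induction n arbitrary: m) (auto simp: depth_prob_eq_0)

text \<open>
  Conditioning on the last step instead of the first. In this form the starting point is fixed, so
  the recurrence can be solved for a chain that starts in \<open>0\<close>.
\<close>
lemma depth_prob_forward:
  "depth_prob (Suc k) m (Suc n) =
    (1 / 2) ^ k * depth_prob k m n + (1 - (1 / 2) ^ Suc k) * depth_prob (Suc k) m n"
proof (induction n arbitrary: m)
  case (Suc n)
  have "depth_prob (Suc k) m (Suc (Suc n)) =
      (1 / 2) ^ m * ((1 / 2) ^ k * depth_prob k (Suc m) n +
        (1 - (1 / 2) ^ Suc k) * depth_prob (Suc k) (Suc m) n) +
      (1 - (1 / 2) ^ m) * ((1 / 2) ^ k * depth_prob k m n +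
        (1 - (1 / 2) ^ Suc k) * depth_prob (Suc k) m n)"
    by (simp only: depth_prob.simps(2)[of _ _ "Suc n"] Suc.IH)
  also have "\<dots> = (1 / 2) ^ k * depth_prob k m (Suc n) +
      (1 - (1 / 2) ^ Suc k) * depth_prob (Suc k) m (Suc n)"
    unfolding depth_prob.simps(2)[of _ _ n] by (simp add: algebra_simps del: power_Suc)
  finally show ?case .
qed auto

section \<open>Closed form of the depth probabilities\<close>

lemma Q_0 [simp]: "Q 0 = 1"
  by (simp add: Q_def)

lemma Q_Suc: "Q (Suc n) = Q n * (1 - (1 / 2) ^ Suc n)"
  by (simp add: Q_def)

text \<open>
  The chain leaves state \<open>i\<close> after a geometric time with ratio \<open>1 - 2\<^sup>-\<^sup>i\<close>, so the probability of
  being in \<open>k\<close> is a combination of the \<open>n\<close>-th powers of these ratios. These are the partial fraction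
  coefficients; the index \<open>j\<close> counts down from \<open>k\<close>.
\<close>
definition mixture_coeff :: "nat \<Rightarrow> nat \<Rightarrow> real" where
  "mixture_coeff k j = (- 1) ^ j * (1 / 2) ^ (j choose 2) / (Q j * Q (k - j))"

lemma Suc_choose_2: "Suc j choose 2 = (j choose 2) + j"
  by (simp add: numeral_2_eq_2)

text \<open>
  The relation that makes the proposed solution satisfy the last-step recurrence, because
  \<open>(1 - 2\<^sup>-\<^sup>(\<^sup>k\<^sup>-\<^sup>j\<^sup>)) - (1 - 2\<^sup>-\<^sup>k) = - 2\<^sup>-\<^sup>k (2\<^sup>j - 1)\<close>.
\<close>
lemma mixture_coeff_Suc_Suc: "(2 ^ Suc j - 1) * mixture_coeff (Suc k) (Suc j) = - 2 * mixture_coeff k j"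
proof -
  have "(1 - (1 / 2 :: real) ^ Suc j) * 2 ^ Suc j = 2 ^ Suc j - 1" "1 - (1 / 2 :: real) ^ Suc j \<noteq> 0"
    using power_Suc_less_one[of "1 / 2 :: real" j] by (simp_all add: field_simps)
  then show ?thesis
    using Q_pos[of j] Q_pos[of "k - j"]
    by (simp add: mixture_coeff_def Q_Suc Suc_choose_2 power_add field_simps del: power_Suc)
       (simp add: power_one_over field_simps)
qed

text \<open>
  Multiplied by \<open>Q k\<close>, the initial condition for \<open>k > 0\<close> becomes the case
  \<open>\<Sum>\<^sub>j (-1)\<^sup>j q^(j choose 2) [k choose j]\<^sub>q = 0\<close> of the \<open>q\<close>-binomial theorem with \<open>q = 1/2\<close>. It is proved through a closed form of its partial sums, which
  follows by telescoping.
\<close>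
lemma sum_mixture_coeff_partial:
  "m \<le> k \<Longrightarrow> (\<Sum>j\<le>m. mixture_coeff (Suc k) j) =
    (- 1) ^ m * (1 / 2) ^ (Suc m choose 2) / (Q m * Q (k - m) * (1 - (1 / 2) ^ Suc k))"
proof (induction m)
  case 0
  then show ?case
    by (simp add: mixture_coeff_def Q_Suc numeral_2_eq_2 del: power_Suc)
next
  case (Suc m)
  define i where "i = k - Suc m"
  have i: "k - m = Suc i" "Suc k - Suc m = Suc i" "Suc k = Suc m + Suc i"
    using Suc.prems by (auto simp: i_def)
  have nz: "1 - (1 / 2 :: real) ^ Suc l \<noteq> 0" for l
    using power_Suc_less_one[of "1 / 2 :: real" l] by linarith
  define x y :: real where "x = (1 / 2) ^ Suc m" and "y = (1 / 2) ^ Suc i"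
  have xy: "x * y \<noteq> 1" "x \<noteq> 1" "y \<noteq> 1"
    using nz[of m] nz[of i] nz[of "m + Suc i"] by (auto simp: x_def y_def power_add mult_ac)
  have "(\<Sum>j\<le>Suc m. mixture_coeff (Suc k) j) =
     (- 1) ^ m * (1 / 2) ^ (Suc m choose 2) / (Q m * Q (Suc i) * (1 - x * y)) +
     (- 1) ^ Suc m * (1 / 2) ^ (Suc m choose 2) / (Q (Suc m) * Q (Suc i))"
    using Suc by (simp only: sum.atMost_Suc i mixture_coeff_def x_def y_def power_add) simp
  also have "\<dots> = (- 1) ^ m * (1 / 2) ^ (Suc m choose 2) / (Q m * Q i) *
      (1 / ((1 - y) * (1 - x * y)) - 1 / ((1 - x) * (1 - y)))"
    unfolding Q_Suc x_def[symmetric] y_def[symmetric]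
    unfolding divide_inverse inverse_mult_distrib by (simp add: algebra_simps)
  also have "1 / ((1 - y) * (1 - x * y)) - 1 / ((1 - x) * (1 - y)) = - x / ((1 - x) * (1 - x * y))"
    using xy by (simp add: divide_simps) (simp add: algebra_simps)
  also have "(- 1) ^ m * (1 / 2) ^ (Suc m choose 2) / (Q m * Q i) * (- x / ((1 - x) * (1 - x * y))) =
      (- 1) ^ Suc m * (1 / 2) ^ (Suc (Suc m) choose 2) / (Q (Suc m) * Q i * (1 - (1 / 2) ^ Suc k))"
    unfolding Suc_choose_2[of "Suc m"] Q_Suc[of m] power_add i x_def y_def by (simp add: mult_ac)
  finally show ?case
    by (simp add: i_def)
qed

lemma sum_mixture_coeff: "(\<Sum>j\<le>k. mixture_coeff k j) = of_bool (k = 0)"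
proof (cases k)
  case 0
  then show ?thesis by (simp add: mixture_coeff_def numeral_2_eq_2)
next
  case (Suc l)
  then show ?thesis
    using sum_mixture_coeff_partial[of l l] by (simp add: mixture_coeff_def Q_Suc del: power_Suc) simp
qed

text \<open>
  The difference \<open>p\<^sub>n\<^sub>+\<^sub>1(k) - (1 - 2\<^sup>-\<^sup>k) p\<^sub>n(k)\<close> kills the term \<open>j = 0\<close> of the sum and, after a shift of
  the index, leaves \<open>2\<^sup>-\<^sup>(\<^sup>k\<^sup>-\<^sup>1\<^sup>) p\<^sub>n(k-1)\<close>.
\<close>
lemma depth_prob_closed_form:
  "depth_prob k 0 n = (\<Sum>j\<le>k. mixture_coeff k j * (1 - (1 / 2) ^ (k - j)) ^ n)"
proof (induction n arbitrary: k)
  case 0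
  show ?case by (auto simp: sum_mixture_coeff)
next
  case (Suc n)
  show ?case
  proof (cases k)
    case 0
    then show ?thesis by (simp add: depth_prob_0_Suc del: depth_prob.simps)
  next
    case (Suc l)
    let ?r = "\<lambda>i. 1 - (1 / 2 :: real) ^ i"
    have step: "mixture_coeff (Suc l) (Suc j) * (?r (l - j) - ?r (Suc l)) = (1 / 2) ^ l * mixture_coeff l j"
      if "j \<le> l" for j
    proof -
      have "?r (l - j) - ?r (Suc l) = - ((1 / 2) ^ Suc l * (2 ^ Suc j - 1))"
        using that by (simp add: power_diff field_simps)
      then show ?thesis
        using mixture_coeff_Suc_Suc[of j l]
        by (simp add: mult.left_commute[of "mixture_coeff _ _"]
            mult.commute[of _ "mixture_coeff _ _"] del: power_Suc) simp
    qed
    have "(\<Sum>j\<le>Suc l. mixture_coeff (Suc l) j * ?r (Suc l - j) ^ Suc n) - ?r (Suc l) * depth_prob (Suc l) 0 n =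
        (\<Sum>j\<le>Suc l. mixture_coeff (Suc l) j * (?r (Suc l - j) - ?r (Suc l)) * ?r (Suc l - j) ^ n)"
      unfolding Suc.IH sum_distrib_left sum_subtractf[symmetric]
      by (intro sum.cong) (simp_all add: algebra_simps)
    also have "\<dots> = (\<Sum>j\<le>l. mixture_coeff (Suc l) (Suc j) * (?r (l - j) - ?r (Suc l)) * ?r (l - j) ^ n)"
      by (subst sum.atMost_Suc_shift) simp
    also have "\<dots> = (1 / 2) ^ l * depth_prob l 0 n"
      unfolding Suc.IH sum_distrib_left
      by (intro sum.cong) (simp_all only: step atMost_iff mult.assoc[symmetric])
    finally show ?thesis
      unfolding \<open>k = Suc l\<close> depth_prob_forward by linarith
  qed
qed

section \<open>Uniform comparison with \<open>F\<close>\<close>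

lemma Q_inf_le_Q: "Q_inf \<le> Q n"
proof (rule decseq_ge[OF _ Q_tendsto_Q_inf])
  show "decseq Q"
    using Q_pos by (intro decseq_SucI) (simp add: Q_Suc mult_left_le less_imp_le)
qed

lemma Q_inf_pos: "Q_inf > 0"
proof -
  have "0 \<le> Q_inf"
    by (rule LIMSEQ_le_const[OF Q_tendsto_Q_inf]) (auto intro: less_imp_le Q_pos)
  then show ?thesis
    using Q_inf_nonzero by simp
qed

lemma Q_le_1: "Q n \<le> 1"
  unfolding Q_def by (intro prod_le_1) (auto simp: power_le_one)

text \<open>
  One factor lowers \<open>Q n\<close> by \<open>Q n * 2\<^sup>-\<^sup>n\<^sup>-\<^sup>1 \<le> 2\<^sup>-\<^sup>n - 2\<^sup>-\<^sup>n\<^sup>-\<^sup>1\<close>, so \<open>Q n - 2\<^sup>-\<^sup>n\<close> increases to its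
  limit \<open>Q_inf\<close>.
\<close>
lemma Q_minus_Q_inf_le: "Q n - Q_inf \<le> (1 / 2) ^ n"
proof -
  have "incseq (\<lambda>n. Q n - (1 / 2) ^ n)"
  proof (rule incseq_SucI)
    fix n
    show "Q n - (1 / 2) ^ n \<le> Q (Suc n) - (1 / 2) ^ Suc n"
      using Q_le_1[of n] by (simp add: Q_Suc algebra_simps)
  qed
  moreover have "(\<lambda>n. Q n - (1 / 2) ^ n) \<longlonglongrightarrow> Q_inf - 0"
    by (intro tendsto_diff Q_tendsto_Q_inf LIMSEQ_power_zero) simp
  ultimately show ?thesis
    using incseq_le[of "\<lambda>n. Q n - (1 / 2) ^ n" Q_inf n] by simp
qed

lemma inverse_Q_minus_inverse_Q_inf_le: "\<bar>1 / Q n - 1 / Q_inf\<bar> \<le> (1 / 2) ^ n / Q_inf ^ 2"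
proof -
  have "\<bar>1 / Q n - 1 / Q_inf\<bar> = (Q n - Q_inf) / (Q n * Q_inf)"
    using Q_inf_pos Q_pos[of n] Q_inf_le_Q[of n] by (simp add: abs_if field_simps)
  also have "\<dots> \<le> (1 / 2) ^ n / Q_inf ^ 2"
    unfolding power2_eq_square
    using Q_inf_pos Q_pos[of n] Q_inf_le_Q[of n] Q_minus_Q_inf_le[of n]
    by (intro frac_le mult_mono mult_pos_pos) auto
  finally show ?thesis .
qed

lemma power_Suc_diff_le:
  fixes a b :: real
  assumes "0 \<le> b" "b \<le> a"
  shows "a ^ Suc n - b ^ Suc n \<le> real (Suc n) * a ^ n * (a - b)"
proof (induction n)
  case (Suc n)
  have "a ^ Suc (Suc n) - b ^ Suc (Suc n) = a * (a ^ Suc n - b ^ Suc n) + b ^ Suc n * (a - b)"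
    by (simp add: algebra_simps)
  also have "\<dots> \<le> a * (real (Suc n) * a ^ n * (a - b)) + a ^ Suc n * (a - b)"
    using assms Suc by (intro add_mono mult_left_mono mult_right_mono power_mono) auto
  finally show ?case
    by (simp add: algebra_simps)
qed simp

text \<open>
  The error is at most \<open>n y\<^sup>2 exp (- (n - 1) y)\<close>. The exponential absorbs the factor \<open>n y\<close>, and what
  remains is linear in \<open>y\<close>, uniformly in \<open>n\<close>. This is what makes the final error bound uniform.
\<close>
lemma power_one_minus_approx_exp:
  fixes y :: real
  assumes "0 \<le> y" "y \<le> 1"
  shows "\<bar>(1 - y) ^ n - exp (- (real n * y))\<bar> \<le> 2 * y"
proof (cases n)
  case (Suc m)
  have le: "1 - y \<le> exp (- y)"
    using exp_ge_add_one_self[of "- y"] by simp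
  have exp_le: "exp (- z) \<le> 1 / (1 + z)" if "z \<ge> 0" for z :: real
    using exp_ge_add_one_self[of z] that by (simp add: exp_minus field_simps)
  have "exp (- y) - (1 - y) \<le> 1 / (1 + y) - (1 - y)"
    using exp_le[of y] assms by simp
  also have "\<dots> = y * y / (1 + y)"
    using assms by (simp add: field_simps)
  also have "\<dots> \<le> y * y"
    using assms by (simp add: divide_le_eq mult_le_cancel_left1)
  finally have gap: "exp (- y) - (1 - y) \<le> y * y" .
  have "exp (- y) ^ m * (real n * y) \<le> 1 / (1 + real m * y) * (real n * y)"
    using exp_le[of "real m * y"] assms
    by (intro mult_right_mono) (simp_all add: exp_of_nat_mult[symmetric])
  also have "\<dots> \<le> 2"
    using assms
    by (simp add: Suc divide_le_eq add_pos_nonneg algebra_simps) (auto intro!: add_increasing2)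
  finally have decay: "exp (- y) ^ m * (real n * y) \<le> 2" .
  have "exp (- y) ^ n - (1 - y) ^ n \<le> real n * exp (- y) ^ m * (exp (- y) - (1 - y))"
    unfolding Suc using assms le by (intro power_Suc_diff_le) auto
  also have "\<dots> \<le> real n * exp (- y) ^ m * (y * y)"
    using gap by (intro mult_left_mono) auto
  also have "\<dots> = exp (- y) ^ m * (real n * y) * y"
    by simp
  also have "\<dots> \<le> 2 * y"
    using decay assms by (intro mult_right_mono) auto
  finally have "exp (- y) ^ n - (1 - y) ^ n \<le> 2 * y" .
  moreover have "(1 - y) ^ n \<le> exp (- y) ^ n"
    using le assms by (intro power_mono) auto
  ultimately show ?thesis
    by (simp add: exp_of_nat_mult[symmetric])
qed (use assms in simp)

text \<open>
  A single summable sequence controls the approximation error, the tail of the series for \<open>F\<close>, and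
  its derivative. The factor \<open>2\<^sup>j\<close> is the one that differentiation produces, and also the
  one in the error scale \<open>2\<^sup>j / 2\<^sup>k\<close> of the \<open>j\<close>-th term; three factors \<open>Q_inf\<close> suffice for all denominators.
\<close>
definition majorant :: "nat \<Rightarrow> real" where
  "majorant j = 2 ^ j * (1 / 2) ^ (j choose 2) / Q_inf ^ 3"

lemma majorant_pos: "majorant j > 0"
  using Q_inf_pos by (simp add: majorant_def)

lemma summable_majorant: "summable majorant"
proof (rule summable_ratio_test[where c = "1 / 2" and N = 2])
  fix j :: nat
  assume j: "2 \<le> j"
  have "(1 / 2 :: real) ^ j \<le> (1 / 2) ^ 2"
    using j by (intro power_decreasing) auto
  moreover have "majorant (Suc j) = (2 * (1 / 2) ^ j) * majorant j"
    by (simp add: majorant_def Suc_choose_2 power_add)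
  ultimately show "norm (majorant (Suc j)) \<le> 1 / 2 * norm (majorant j)"
    using majorant_pos[of j] by (simp add: power2_eq_square mult_right_mono)
qed simp

lemma F_term_le_majorant: "2 ^ j * \<bar>F_term x j\<bar> \<le> majorant j * exp (- (2 ^ j * x))"
proof -
  have "Q_inf ^ 3 \<le> Q j * Q_inf"
    unfolding power3_eq_cube
    using Q_inf_pos Q_inf_le_Q[of j] Q_inf_le_Q[of 0] Q_pos[of j]
      mult_mono[of Q_inf "Q j" Q_inf 1]
    by (intro mult_right_mono) auto
  then have "2 ^ j * (1 / 2) ^ (j choose 2) / (Q j * Q_inf) \<le> majorant j"
    unfolding majorant_def using Q_inf_pos by (intro divide_left_mono) (auto simp: Q_pos)
  then have "2 ^ j * (1 / 2) ^ (j choose 2) / (Q j * Q_inf) * exp (- (2 ^ j * x)) \<le>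
      majorant j * exp (- (2 ^ j * x))"
    by (rule mult_right_mono) simp
  then show ?thesis
    using Q_inf_pos Q_pos[of j] by (simp add: F_term_def abs_mult power_abs)
qed

text \<open>
  With \<open>y = 2\<^sup>j / 2\<^sup>k\<close>, replacing \<open>Q (k - j)\<close> by \<open>Q_inf\<close> and \<open>(1 - y)\<^sup>n\<close> by \<open>exp (- n y)\<close> costs
  \<open>O(y)\<close> each.
\<close>
lemma mixture_term_approx_F_term:
  assumes "j \<le> k"
  shows "\<bar>mixture_coeff k j * (1 - (1 / 2) ^ (k - j)) ^ n - F_term (real n / 2 ^ k) j\<bar> \<le>
    3 * majorant j / 2 ^ k"
proof -
  define y :: real where "y = (1 / 2) ^ (k - j)"
  have y: "0 \<le> y" "y \<le> 1" "y = 2 ^ j / 2 ^ k"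
    using assms by (auto simp: y_def power_le_one power_diff power_one_over field_simps)
  define a where "a = (1 / 2 :: real) ^ (j choose 2) / Q j"
  have a: "0 \<le> a" "a \<le> (1 / 2) ^ (j choose 2) / Q_inf"
    unfolding a_def using Q_pos[of j] Q_inf_pos Q_inf_le_Q[of j]
    by (auto intro!: divide_left_mono)
  let ?p = "(1 - y) ^ n" and ?e = "exp (- (real n * y))"
  have "\<bar>?p / Q (k - j) - ?e / Q_inf\<bar> = \<bar>(1 / Q (k - j) - 1 / Q_inf) * ?p + (?p - ?e) / Q_inf\<bar>"
    by (simp add: left_diff_distrib diff_divide_distrib)
  also have "\<dots> \<le> \<bar>1 / Q (k - j) - 1 / Q_inf\<bar> * ?p + \<bar>?p - ?e\<bar> / Q_inf"
    using y Q_inf_pos by (intro order_trans[OF abs_triangle_ineq]) (simp add: abs_mult)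
  also have "\<dots> \<le> y / Q_inf ^ 2 * 1 + 2 * y / Q_inf"
    using y Q_inf_pos inverse_Q_minus_inverse_Q_inf_le[of "k - j"]
      power_one_minus_approx_exp[of y n]
    by (intro add_mono mult_mono divide_right_mono) (auto simp: y_def intro: power_le_one)
  also have "2 * y / Q_inf \<le> 2 * y / Q_inf ^ 2"
    using y Q_inf_pos Q_inf_le_Q[of 0]
    by (intro divide_left_mono) (auto simp: power2_eq_square mult_left_le)
  finally have "\<bar>?p / Q (k - j) - ?e / Q_inf\<bar> \<le> 3 * y / Q_inf ^ 2"
    by simp
  then have "a * \<bar>?p / Q (k - j) - ?e / Q_inf\<bar> \<le>
      (1 / 2) ^ (j choose 2) / Q_inf * (3 * y / Q_inf ^ 2)"
    using a by (intro mult_mono) auto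
  also have "\<dots> = 3 * majorant j / 2 ^ k"
    by (simp add: majorant_def y(3) power3_eq_cube power2_eq_square mult_ac)
  also have "a * \<bar>?p / Q (k - j) - ?e / Q_inf\<bar> =
      \<bar>(- 1) ^ j * a * (?p / Q (k - j) - ?e / Q_inf)\<bar>"
    using a by (simp add: abs_mult power_abs)
  also have "(- 1) ^ j * a * (?p / Q (k - j) - ?e / Q_inf) =
      mixture_coeff k j * ?p - F_term (real n / 2 ^ k) j"
    by (simp add: mixture_coeff_def F_term_def a_def y(3) algebra_simps)
  finally show ?thesis
    by (simp add: y_def)
qed

text \<open>
  The terms of the finite sum and of the series differ by \<open>O(majorant j / 2\<^sup>k)\<close> each. For \<open>j > k\<close> the
  finite sum has no term; there \<open>2\<^sup>k < 2\<^sup>j\<close>, and the term of the series itself is that small.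
\<close>
lemma depth_prob_approx_F:
  "2 ^ k * \<bar>depth_prob k 0 n - F (real n / 2 ^ k)\<bar> \<le> 3 * suminf majorant"
proof -
  define x where "x = real n / 2 ^ k"
  define G where "G j = (if j \<le> k then mixture_coeff k j * (1 - (1 / 2) ^ (k - j)) ^ n else 0)" for j
  have "x \<ge> 0"
    by (simp add: x_def)
  have "G sums (\<Sum>j\<le>k. G j)"
    by (intro sums_finite) (auto simp: G_def)
  then have "G sums depth_prob k 0 n"
    by (simp add: depth_prob_closed_form G_def)
  moreover have "F_term x sums F x"
    unfolding F_def using summable_F_term[OF \<open>x \<ge> 0\<close>] by (rule summable_sums)
  ultimately have diff: "(\<lambda>j. G j - F_term x j) sums (depth_prob k 0 n - F x)"
    by (rule sums_diff)
  have bound: "\<bar>G j - F_term x j\<bar> \<le> 3 * majorant j / 2 ^ k" for j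
  proof (cases "j \<le> k")
    case True
    then show ?thesis
      using mixture_term_approx_F_term[of j k n] by (simp add: G_def x_def)
  next
    case False
    have "2 ^ k * \<bar>F_term x j\<bar> \<le> 2 ^ j * \<bar>F_term x j\<bar>"
      using False by (intro mult_right_mono power_increasing) auto
    also have "\<dots> \<le> majorant j * exp (- (2 ^ j * x))"
      by (rule F_term_le_majorant)
    also have "\<dots> \<le> 3 * majorant j"
      using majorant_pos[of j] \<open>x \<ge> 0\<close>
      by (subst mult.commute, intro mult_right_mono) (auto intro: order_trans[of _ 1])
    finally show ?thesis
      using False by (simp add: G_def field_simps)
  qed
  have "(\<lambda>j. 3 * majorant j / 2 ^ k) sums (3 * suminf majorant / 2 ^ k)"
    by (intro sums_divide sums_mult summable_sums summable_majorant)
  then have "\<bar>depth_prob k 0 n - F x\<bar> \<le> 3 * suminf majorant / 2 ^ k"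
    using suminf_le[of "\<lambda>j. \<bar>G j - F_term x j\<bar>" "\<lambda>j. 3 * majorant j / 2 ^ k"]
      summable_rabs[of "\<lambda>j. G j - F_term x j"] diff bound
      summable_comparison_test[of "\<lambda>j. \<bar>G j - F_term x j\<bar>" "\<lambda>j. 3 * majorant j / 2 ^ k"]
    by (fastforce simp: sums_iff)
  then show ?thesis
    by (simp add: x_def field_simps)
qed

section \<open>Positivity of \<open>F\<close>\<close>

lemma F_term_dilation: "(2 ^ Suc j - 1) * F_term x (Suc j) = - 2 * F_term (2 * x) j"
proof -
  have "(1 - (1 / 2 :: real) ^ Suc j) * 2 ^ Suc j = 2 ^ Suc j - 1" "1 - (1 / 2 :: real) ^ Suc j \<noteq> 0"
    using power_Suc_less_one[of "1 / 2 :: real" j] by (simp_all add: field_simps)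
  moreover have "exp (- (2 ^ Suc j * x)) = exp (- (2 ^ j * (2 * x)))"
    by (simp add: mult_ac)
  moreover have "Q j \<noteq> 0" "Q_inf \<noteq> 0"
    using Q_pos[of j] Q_inf_nonzero by auto
  ultimately show ?thesis
    by (simp add: F_term_def Q_Suc Suc_choose_2 power_add field_simps del: power_Suc)
       (simp add: power_one_over field_simps)
qed

text \<open>
  The derivative multiplies the \<open>j\<close>-th term by \<open>- 2\<^sup>j = - 1 - (2\<^sup>j - 1)\<close>. The first part gives \<open>- F x\<close>;
  the second turns each term into a term at \<open>2 x\<close> with a lower index.
\<close>
lemma has_derivative_F:
  assumes "x > 0"
  shows "(F has_real_derivative (2 * F (2 * x) - F x)) (at x)"
proof -
  define f' where "f' j x = - (2 ^ j) * F_term x j" for j x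
  have "((\<lambda>x. \<Sum>j. F_term x j) has_real_derivative (\<Sum>j. f' j x)) (at x)"
  proof (rule has_field_derivative_series'[where S = "{0<..}" and f' = f'])
    show "((\<lambda>x. F_term x j) has_real_derivative f' j x) (at x within {0<..})" if "x \<in> {0<..}" for j x
      unfolding F_term_def f'_def
      using Q_pos[of j] Q_inf_pos by (auto intro!: derivative_eq_intros)
    show "uniformly_convergent_on {0<..} (\<lambda>n x. \<Sum>i<n. f' i x)"
    proof (rule Weierstrass_m_test'[OF _ summable_majorant])
      fix j and x :: real assume "x \<in> {0<..}"
      then show "norm (f' j x) \<le> majorant j"
        using F_term_le_majorant[of j x] majorant_pos[of j]
        by (auto simp: f'_def abs_mult intro: order_trans[OF _ mult_left_le])
    qed
    show "summable (\<lambda>j. F_term 1 j)"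
      using summable_F_term[of 1] by simp
  qed (use assms in \<open>auto simp: interior_open\<close>)
  moreover have "(\<lambda>j. f' j x) sums (2 * F (2 * x) - F x)"
  proof -
    have F: "F_term y sums F y" if "y \<ge> 0" for y
      unfolding F_def using summable_F_term[OF that] by (rule summable_sums)
    have "(\<lambda>j. (2 ^ Suc j - 1) * F_term x (Suc j)) sums (- 2 * F (2 * x))"
      unfolding F_term_dilation using F[of "2 * x"] assms by (intro sums_mult) auto
    then have "(\<lambda>j. (2 ^ j - 1) * F_term x j) sums (- 2 * F (2 * x) + (2 ^ 0 - 1) * F_term x 0)"
      by (rule sums_Suc)
    from sums_add[OF this F[of x]] have "(\<lambda>j. 2 ^ j * F_term x j) sums (F x - 2 * F (2 * x))"
      using assms by (simp add: algebra_simps)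
    then show ?thesis
      unfolding f'_def using sums_minus by fastforce
  qed
  ultimately show ?thesis
    by (simp add: F_def[abs_def] sums_iff)
qed

lemma has_derivative_exp_F:
  assumes "x > 0"
  shows "((\<lambda>x. exp x * F x) has_real_derivative (2 * exp x * F (2 * x))) (at x)"
  using has_derivative_F[OF assms]
  by (auto intro!: derivative_eq_intros simp: algebra_simps)

text \<open>
  The series alternates, so its sign cannot be read off. But \<open>F x\<close> is the limit of the
  probabilities \<open>depth_prob k 0 n\<close> along \<open>n = \<lfloor>2\<^sup>k x\<rfloor>\<close>.
\<close>
lemma F_nonneg:
  assumes "x > 0"
  shows "F x \<ge> 0"
proof (rule LIMSEQ_le)
  let ?n = "\<lambda>k. nat \<lfloor>2 ^ k * x\<rfloor>"
  have half: "(\<lambda>k. c / 2 ^ k) \<longlonglongrightarrow> 0" for c :: real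
    using tendsto_mult[OF tendsto_const[of c] LIMSEQ_power_zero[of "1 / 2 :: real"]]
    by (simp add: power_one_over)
  have "(\<lambda>k. real (?n k) / 2 ^ k) \<longlonglongrightarrow> x"
  proof (rule tendsto_sandwich)
    have "2 ^ k * x - 1 \<le> real (?n k)" "real (?n k) \<le> 2 ^ k * x" for k
      using assms by simp_all
    then have "(2 ^ k * x - 1) / 2 ^ k \<le> real (?n k) / 2 ^ k"
      "real (?n k) / 2 ^ k \<le> 2 ^ k * x / 2 ^ k" for k
      by (intro divide_right_mono; simp)+
    then show "\<forall>\<^sub>F k in sequentially. x - 1 / 2 ^ k \<le> real (?n k) / 2 ^ k"
      "\<forall>\<^sub>F k in sequentially. real (?n k) / 2 ^ k \<le> x"
      by (simp_all add: diff_divide_distrib)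
    show "(\<lambda>k. x - 1 / 2 ^ k) \<longlonglongrightarrow> x"
      using tendsto_diff[OF tendsto_const[of x] half[of 1]] by simp
  qed simp
  moreover have "isCont F x"
    using has_derivative_F[OF assms] by (rule DERIV_isCont)
  ultimately show "(\<lambda>k. F (real (?n k) / 2 ^ k)) \<longlonglongrightarrow> F x"
    by (rule isCont_tendsto_compose[rotated])
  show "(\<lambda>k. - (3 * suminf majorant / 2 ^ k)) \<longlonglongrightarrow> 0"
    using tendsto_minus[OF half[of "3 * suminf majorant"]] by simp
  have "- (3 * suminf majorant / 2 ^ k) \<le> F (real (?n k) / 2 ^ k)" for k
  proof -
    have "\<bar>depth_prob k 0 (?n k) - F (real (?n k) / 2 ^ k)\<bar> \<le> 3 * suminf majorant / 2 ^ k"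
      using depth_prob_approx_F[of k "?n k"] by (simp add: field_simps)
    then show ?thesis
      using depth_prob_nonneg[of k 0 "?n k"] by linarith
  qed
  then show "\<exists>N. \<forall>k\<ge>N. - (3 * suminf majorant / 2 ^ k) \<le> F (real (?n k) / 2 ^ k)"
    by blast
qed

lemma exp_F_mono:
  assumes "0 < x" "x \<le> y"
  shows "exp x * F x \<le> exp y * F y"
proof (rule DERIV_nonneg_imp_nondecreasing[OF assms(2)])
  fix z assume "x \<le> z" "z \<le> y"
  then show "\<exists>D. ((\<lambda>x. exp x * F x) has_real_derivative D) (at z) \<and> D \<ge> 0"
    using has_derivative_exp_F[of z] F_nonneg[of "2 * z"] assms by fastforce
qed

text \<open>
  The leading term of the series is \<open>exp (- x) / Q_inf\<close>, and all others carry a factor of at most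
  \<open>exp (- 2 x)\<close>.
\<close>
lemma exp_F_tendsto: "((\<lambda>x. exp x * F x) \<longlongrightarrow> 1 / Q_inf) at_top"
proof -
  have "\<bar>exp x * F x - 1 / Q_inf\<bar> \<le> suminf majorant * exp (- x)" if "x \<ge> 0" for x
  proof -
    have "(\<lambda>j. F_term x (Suc j)) sums (F x - F_term x 0)"
      unfolding F_def using summable_F_term[OF that] by (simp add: sums_Suc_iff summable_sums)
    moreover have "(\<lambda>j. majorant (Suc j) * exp (- (2 * x))) sums
        ((suminf majorant - majorant 0) * exp (- (2 * x)))"
      using summable_majorant by (intro sums_mult2) (simp add: sums_Suc_iff summable_sums)
    moreover have "\<bar>F_term x (Suc j)\<bar> \<le> majorant (Suc j) * exp (- (2 * x))" for j
    proof -
      have "\<bar>F_term x (Suc j)\<bar> \<le> 2 ^ Suc j * \<bar>F_term x (Suc j)\<bar>"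
        using one_le_power[of "2 :: real" "Suc j"] by (simp add: mult_le_cancel_right1 del: power_Suc)
      also have "\<dots> \<le> majorant (Suc j) * exp (- (2 ^ Suc j * x))"
        by (rule F_term_le_majorant)
      also have "\<dots> \<le> majorant (Suc j) * exp (- (2 * x))"
        using majorant_pos[of "Suc j"] that one_le_power[of "2 :: real" j]
        by (intro mult_left_mono) (auto simp: mult_le_cancel_right1)
      finally show ?thesis .
    qed
    ultimately have "\<bar>F x - F_term x 0\<bar> \<le> (suminf majorant - majorant 0) * exp (- (2 * x))"
      using norm_sums_le[of "\<lambda>j. F_term x (Suc j)"] by force
    also have "\<dots> \<le> suminf majorant * exp (- (2 * x))"
      using majorant_pos[of 0] by (intro mult_right_mono) auto
    finally have "exp x * \<bar>F x - F_term x 0\<bar> \<le> exp x * (suminf majorant * exp (- (2 * x)))"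
      by simp
    also have "\<dots> = suminf majorant * exp (- x)"
      by (simp add: exp_minus field_simps flip: exp_add)
    also have "exp x * \<bar>F x - F_term x 0\<bar> = \<bar>exp x * (F x - F_term x 0)\<bar>"
      by (simp add: abs_mult)
    also have "exp x * (F x - F_term x 0) = exp x * F x - 1 / Q_inf"
      by (simp add: F_term_def numeral_2_eq_2 right_diff_distrib exp_minus)
    finally show ?thesis .
  qed
  then have "\<forall>\<^sub>F x in at_top. norm (exp x * F x - 1 / Q_inf) \<le> suminf majorant * exp (- x)"
    by (intro eventually_mono[OF eventually_ge_at_top[of 0]]) simp
  moreover have "((\<lambda>x. suminf majorant * exp (- x :: real)) \<longlongrightarrow> 0) at_top"
    by (intro tendsto_mult_right_zero filterlim_compose[OF exp_at_bot] filterlim_uminus_at_bot_at_top)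
  ultimately have "((\<lambda>x. exp x * F x - 1 / Q_inf) \<longlongrightarrow> 0) at_top"
    by (rule Lim_null_comparison)
  then show ?thesis
    by (simp add: Lim_null[symmetric])
qed

text \<open>
  By monotonicity of \<open>exp x * F x\<close>, a zero at \<open>y\<close> forces \<open>F = 0\<close> on \<open>(0, y]\<close>. Then the derivative of
  \<open>exp x * F x\<close>, which is a positive multiple of \<open>F (2 x)\<close>, vanishes on \<open>(0, y)\<close>, so that \<open>F = 0\<close> on \<open>(0, 2 y)\<close>.
  Zeros therefore spread to infinity, against the positive limit of \<open>exp x * F x\<close>.
\<close>
lemma F_pos:
  assumes "x > 0"
  shows "F x > 0"
proof (rule ccontr)
  assume "\<not> F x > 0"
  then have "F x = 0"
    using F_nonneg[OF assms] by simp
  have spread: "F (3 / 2 * y) = 0" if y: "y > 0" "F y = 0" for y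
  proof -
    have zero: "exp z * F z = 0" if "0 < z" "z \<le> y" for z
      using exp_F_mono[OF that] y F_nonneg[of z] that by (simp add: mult_le_0_iff)
    \<comment> \<open>A point inside \<open>(0, y)\<close> whose double lies beyond \<open>y\<close>, so that zeros move outwards.\<close>
    let ?z = "3 / 4 * y"
    have "((\<lambda>z. exp z * F z) has_real_derivative (2 * exp ?z * F (2 * ?z))) (at ?z)"
      using y by (intro has_derivative_exp_F) auto
    moreover have "((\<lambda>z. exp z * F z) has_real_derivative 0) (at ?z)"
      by (rule has_field_derivative_transform_within_open[of "\<lambda>_. 0" _ _ "{0<..<y}"])
         (use y zero in auto)
    ultimately have "2 * exp ?z * F (2 * ?z) = 0"
      by (rule DERIV_unique)
    then show ?thesis by simp
  qed
  have iter: "F ((3 / 2) ^ n * x) = 0" for n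
  proof (induction n)
    case (Suc n)
    then show ?case
      using spread[of "(3 / 2) ^ n * x"] assms by (simp add: mult.assoc)
  qed (use \<open>F x = 0\<close> in simp)
  have "filterlim (\<lambda>n. (3 / 2 :: real) ^ n * x) at_top sequentially"
    using assms by real_asymp
  from filterlim_compose[OF exp_F_tendsto this] have "(\<lambda>n. 0) \<longlonglongrightarrow> 1 / Q_inf"
    by (simp add: iter)
  then show False
    using Q_inf_pos by (simp add: LIMSEQ_const_iff)
qed

theorem theorem1:
  shows "(\<forall>x>0. F x > 0) \<and>
    (\<exists>C. \<forall>n k. k \<le> n \<longrightarrow> \<bar>mean_B n k - 2 ^ k * F (real n / 2 ^ k)\<bar> \<le> C)"
proof (intro conjI exI allI impI)
  fix n k :: nat
  have "\<bar>mean_B n k - 2 ^ k * F (real n / 2 ^ k)\<bar> = 2 ^ k * \<bar>depth_prob k 0 n - F (real n / 2 ^ k)\<bar>"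
    by (simp add: mean_B_eq_depth_prob abs_mult flip: right_diff_distrib)
  also have "\<dots> \<le> 3 * suminf majorant"
    by (rule depth_prob_approx_F)
  finally show "\<bar>mean_B n k - 2 ^ k * F (real n / 2 ^ k)\<bar> \<le> 3 * suminf majorant" .
qed (rule F_pos)

end
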